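(* Let $G_{k}=(V,E)$ be a square grid ($k=4$), or a triangular grid ($k=6$), or a hexagonal grid ($k=3$), let $d>0$, let $f:\mathbb{R}\to\mathbb{R}$ be continuous, and consider on $G_k$ the equation $$\dot{u}_i(t) = d \sum_{j \in N(i)}(u_j(t)-u_i(t))+f(u_i(t)), \quad i \in V,\ t>0. \qquad (\mathrm{GDE})$$ Then for each pair of linearly independent vectors $v_1, v_2 \in \mathbb{Z}^2$ (all of whose coordinates are even if $G_{k}$ is the hexagonal grid) there exist $n\in\mathbb{N}$ and a matrix $\mathbf{m} \in \mathbb{N}_0^{n \times n}$ such that every $(v_1,v_2)$-periodic stationary solution of (GDE) is $\mathbf{m}$-perfect.
   Context: The square/triangular/hexagonal grid is the graph of vertices and edges of the regular tessellation of $\mathbb{R}^2$ by squares/equilateral triangles/regular hexagons. In each case the vertices are placed at the points of $V=\mathbb{Z}^2$: in the square grid $x$ is adjacent to $x\pm(1,0)$, $x\pm(0,1)$; in the triangular grid $x$ is adjacent to $x\pm(1,0)$, $x\pm(0,1)$, $x\pm(1,-1)$; in the hexagonal grid (brick-wall layout) $(x,y)$ is adjacent to $(x\pm1,y)$ and to $(x,y+1)$ if $x+y$ is even, to $(x,y-1)$ if $x+y$ is odd. $N(i)$ is the set of neighbors of $i$. A stationary solution of (GDE) is a map $u:V\to\mathbb{R}$ with $0=d\sum_{j\in N(i)}(u_j-u_i)+f(u_i)$ for all $i\in V$; $\mathrm{Im}(u)$ is its set of values. It is $(v_1,v_2)$-periodic if $u_i=u_{i+v_1}=u_{i+v_2}$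 for all $i\in V$. For $C=\{1,\dots,n\}$ and $\mathbf{m}\in\mathbb{N}_0^{n\times n}$ with all row sums equal to $k$, a coloring $\Gamma:V\to C$ is $\mathbf{m}$-perfect if for every $i\in V$ and every $c\in C$ the number of $j\in N(i)$ with $\Gamma(j)=c$ equals $m_{\Gamma(i)c}$. A stationary solution $u$ is $\mathbf{m}$-perfect (where $\mathbf{m}$ has all row sums equal to $k$) if there exist an $\mathbf{m}$-perfect coloring $\Gamma$ of $G_k$ and a surjection $v:C\to\mathrm{Im}(u)$ such that $v_{\Gamma(i)}=u_i$ for every $i\in V$. *)

theory Defs
  imports "HOL-Analysis.Analysis"
begin

type_synonym vertex = "int \<times> int"

datatype grid = Square | Triangular | Hexagonal

fun grid_degree :: "grid \<Rightarrow> nat" where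
  "grid_degree Square = 4"
| "grid_degree Triangular = 6"
| "grid_degree Hexagonal = 3"

text \<open>The hexagonal grid is drawn in the brick-wall layout, so its vertical edges depend on the
  parity of \<open>x + y\<close>.\<close>

fun neighbors :: "grid \<Rightarrow> vertex \<Rightarrow> vertex set" where
  "neighbors Square (x, y) = {(x + 1, y), (x - 1, y), (x, y + 1), (x, y - 1)}"
| "neighbors Triangular (x, y) =
     {(x + 1, y), (x - 1, y), (x, y + 1), (x, y - 1), (x + 1, y - 1), (x - 1, y + 1)}"
| "neighbors Hexagonal (x, y) =
     {(x + 1, y), (x - 1, y), (if even (x + y) then (x, y + 1) else (x, y - 1))}"

lemma card_neighbors: "card (neighbors G i) = grid_degree G"
  by (cases G; cases i) auto

definition stationary_solution :: "grid \<Rightarrow> real \<Rightarrow> (real \<Rightarrow> real) \<Rightarrow> (vertex \<Rightarrow> real) \<Rightarrow> bool" where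
  "stationary_solution G d f u \<longleftrightarrow>
     (\<forall>i. 0 = d * (\<Sum>j\<in>neighbors G i. u j - u i) + f (u i))"

definition periodic :: "vertex \<Rightarrow> vertex \<Rightarrow> (vertex \<Rightarrow> real) \<Rightarrow> bool" where
  "periodic v1 v2 u \<longleftrightarrow> (\<forall>i. u i = u (i + v1) \<and> u i = u (i + v2))"

definition real_pair :: "vertex \<Rightarrow> real \<times> real" where
  "real_pair v = (real_of_int (fst v), real_of_int (snd v))"

text \<open>The pair is required to be independent as a family: since \<open>independent\<close> speaks about sets,
  the degenerate case of two equal vectors has to be excluded separately.\<close>

definition lin_indep_pair :: "vertex \<Rightarrow> vertex \<Rightarrow> bool" where
  "lin_indep_pair v1 v2 \<longleftrightarrow> v1 \<noteq> v2 \<and> independent {real_pair v1, real_pair v2}"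

definition even_vector :: "vertex \<Rightarrow> bool" where
  "even_vector v \<longleftrightarrow> even (fst v) \<and> even (snd v)"

text \<open>An \<open>n \<times> n\<close> matrix over the natural numbers is a function \<open>m\<close> of which only the entries
  \<open>m a b\<close> with \<open>a, b \<in> {1..n}\<close> matter; the colors are \<open>{1..n}\<close>.\<close>

definition row_sums_eq :: "nat \<Rightarrow> (nat \<Rightarrow> nat \<Rightarrow> nat) \<Rightarrow> nat \<Rightarrow> bool" where
  "row_sums_eq n m k \<longleftrightarrow> (\<forall>a\<in>{1..n}. (\<Sum>b\<in>{1..n}. m a b) = k)"

definition perfect_coloring ::
    "grid \<Rightarrow> nat \<Rightarrow> (nat \<Rightarrow> nat \<Rightarrow> nat) \<Rightarrow> (vertex \<Rightarrow> nat) \<Rightarrow> bool" where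
  "perfect_coloring G n m \<Gamma> \<longleftrightarrow>
     (\<forall>i. \<Gamma> i \<in> {1..n}) \<and>
     (\<forall>i. \<forall>c\<in>{1..n}. card {j \<in> neighbors G i. \<Gamma> j = c} = m (\<Gamma> i) c)"

definition perfect_solution ::
    "grid \<Rightarrow> nat \<Rightarrow> (nat \<Rightarrow> nat \<Rightarrow> nat) \<Rightarrow> (vertex \<Rightarrow> real) \<Rightarrow> bool" where
  "perfect_solution G n m u \<longleftrightarrow>
     (\<exists>\<Gamma> v. perfect_coloring G n m \<Gamma> \<and> v ` {1..n} = range u \<and> (\<forall>i. v (\<Gamma> i) = u i))"

end

theory Submission
  imports Defs
begin

text \<open>The coloring does not depend on the solution: color each vertex by its coset modulo the
  lattice \<open>L\<close> spanned by \<open>v1\<close> and \<open>v2\<close>. A periodic function is constant on cosets, so its values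
  can be read off from the colors. Linear independence makes
  \<open>L\<close> a subgroup of finite index (lemma \<open>finite_cosets\<close>), so finitely many colors suffice. The
  coloring is perfect because translation by a vector of \<open>L\<close> is an automorphism of the grid (for the
  brick-wall layout this is where the even coordinates enter) that preserves colors: two vertices
  of the same color therefore see the same colors equally often (lemma
  \<open>card_colored_neighbors_cong\<close>). The matrix \<open>m\<close> records these counts at one representative of each
  color.\<close>

definition lattice :: "vertex \<Rightarrow> vertex \<Rightarrow> vertex set" where
  "lattice v1 v2 = {(a * fst v1 + b * fst v2, a * snd v1 + b * snd v2) | a b. True}"

definition coset :: "vertex \<Rightarrow> vertex \<Rightarrow> vertex \<Rightarrow> vertex set" where
  "coset v1 v2 i = {j. j - i \<in> lattice v1 v2}"

lemma latticeI:
  "w = (a * fst v1 + b * fst v2, a * snd v1 + b * snd v2) \<Longrightarrow> w \<in> lattice v1 v2"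
  unfolding lattice_def by blast

lemma lattice_zero: "0 \<in> lattice v1 v2"
  by (rule latticeI[where a = 0 and b = 0]) (simp add: zero_prod_def)

lemma lattice_diff:
  assumes "s \<in> lattice v1 v2" "t \<in> lattice v1 v2"
  shows "s - t \<in> lattice v1 v2"
proof -
  obtain a b a' b'
    where "s = (a * fst v1 + b * fst v2, a * snd v1 + b * snd v2)"
      and "t = (a' * fst v1 + b' * fst v2, a' * snd v1 + b' * snd v2)"
    using assms unfolding lattice_def by blast
  then show ?thesis
    by (intro latticeI[where a = "a - a'" and b = "b - b'"]) (simp add: algebra_simps)
qed

lemma lattice_add:
  assumes "s \<in> lattice v1 v2" "t \<in> lattice v1 v2"
  shows "s + t \<in> lattice v1 v2"
  using lattice_diff[OF assms(1) lattice_diff[OF lattice_zero assms(2)]] by simp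

lemma coset_eq_iff: "coset v1 v2 i = coset v1 v2 j \<longleftrightarrow> j - i \<in> lattice v1 v2"
proof
  assume "coset v1 v2 i = coset v1 v2 j"
  moreover have "j \<in> coset v1 v2 j"
    by (simp add: coset_def lattice_zero)
  ultimately show "j - i \<in> lattice v1 v2"
    by (auto simp: coset_def)
next
  assume ij: "j - i \<in> lattice v1 v2"
  have "k - i \<in> lattice v1 v2 \<longleftrightarrow> k - j \<in> lattice v1 v2" for k
    using lattice_diff[OF _ ij, of "k - i"] lattice_add[OF _ ij, of "k - j"] by auto
  then show "coset v1 v2 i = coset v1 v2 j"
    by (simp add: coset_def)
qed

lemma lin_indep_pair_det:
  assumes "lin_indep_pair v1 v2"
  shows "fst v1 * snd v2 - fst v2 * snd v1 \<noteq> 0"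
proof
  assume "fst v1 * snd v2 - fst v2 * snd v1 = 0"
  then have det: "real_of_int (fst v1) * real_of_int (snd v2)
      = real_of_int (fst v2) * real_of_int (snd v1)"
    by (metis eq_iff_diff_eq_0 of_int_mult)
  have ne: "real_pair v1 \<noteq> real_pair v2"
    using assms unfolding lin_indep_pair_def real_pair_def by (auto simp: prod_eq_iff)
  then have notin: "real_pair v1 \<notin> span {real_pair v2}" and nz: "real_pair v2 \<noteq> 0"
    using assms unfolding lin_indep_pair_def
    by (auto simp: independent_insert)
  have "\<exists>c. real_pair v1 = c *\<^sub>R real_pair v2"
  proof (cases "fst v2 = 0")
    case True
    then have "snd v2 \<noteq> 0"
      using nz by (auto simp: real_pair_def zero_prod_def)
    with det True have "real_pair v1 = (snd v1 / snd v2) *\<^sub>R real_pair v2"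
      by (simp add: real_pair_def)
    then show ?thesis ..
  next
    case False
    with det have "real_pair v1 = (fst v1 / fst v2) *\<^sub>R real_pair v2"
      by (simp add: real_pair_def field_simps)
    then show ?thesis ..
  qed
  with notin show False
    by (auto simp: span_singleton)
qed

text \<open>By Cramer's rule, \<open>L\<close> contains \<open>D \<int>\<^sup>2\<close> for the determinant \<open>D\<close> of the two vectors, so
  reducing both coordinates modulo \<open>D\<close> leaves the coset unchanged.\<close>

lemma finite_cosets:
  assumes "lin_indep_pair v1 v2"
  shows "finite (range (coset v1 v2))"
proof -
  define D where "D = fst v1 * snd v2 - fst v2 * snd v1"
  have D: "D \<noteq> 0"
    using lin_indep_pair_det[OF assms] by (simp add: D_def)
  let ?B = "{-\<bar>D\<bar>..\<bar>D\<bar>} \<times> {-\<bar>D\<bar>..\<bar>D\<bar>}"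
  have "coset v1 v2 i \<in> coset v1 v2 ` ?B" for i
  proof -
    obtain p q where i: "i = (p, q)"
      by (cases i)
    define s t where "s = p div D" and "t = q div D"
    have "p - p mod D = D * s" "q - q mod D = D * t"
      by (simp_all add: s_def t_def minus_mod_eq_mult_div)
    then have "i - (p mod D, q mod D) \<in> lattice v1 v2"
      by (intro latticeI[where a = "s * snd v2 - t * fst v2" and b = "t * fst v1 - s * snd v1"])
        (simp add: i D_def algebra_simps)
    then have "coset v1 v2 i = coset v1 v2 (p mod D, q mod D)"
      by (simp add: coset_eq_iff[symmetric])
    moreover have "(p mod D, q mod D) \<in> ?B"
      using abs_mod_less[OF D, of p] abs_mod_less[OF D, of q] by auto
    ultimately show ?thesis
      by blast
  qed
  then have "range (coset v1 v2) \<subseteq> coset v1 v2 ` ?B"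
    by blast
  then show ?thesis
    by (rule finite_subset) simp
qed

lemma periodic_multiple:
  fixes u :: "vertex \<Rightarrow> 'a"
  assumes "\<And>i. u i = u (i + w)"
  shows "u (i + (a * fst w, a * snd w)) = u i"
proof (induction a rule: int_induct[where k = 0])
  case base
  show ?case by (simp flip: zero_prod_def)
next
  case (step1 a)
  have "i + ((a + 1) * fst w, (a + 1) * snd w) = (i + (a * fst w, a * snd w)) + w"
    by (simp add: prod_eq_iff algebra_simps)
  then show ?case
    using step1 assms by metis
next
  case (step2 a)
  have "i + (a * fst w, a * snd w) = (i + ((a - 1) * fst w, (a - 1) * snd w)) + w"
    by (simp add: prod_eq_iff algebra_simps)
  then show ?case
    using step2 assms by metis
qed

lemma periodic_coset_eq:
  assumes "periodic v1 v2 u" and "coset v1 v2 i = coset v1 v2 j"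
  shows "u i = u j"
proof -
  obtain a b where "j - i = (a * fst v1 + b * fst v2, a * snd v1 + b * snd v2)"
    using assms(2) unfolding coset_eq_iff lattice_def by blast
  then have "j = (i + (a * fst v1, a * snd v1)) + (b * fst v2, b * snd v2)"
    by (simp add: prod_eq_iff algebra_simps)
  moreover have "u (k + (a * fst v1, a * snd v1)) = u k" "u (k + (b * fst v2, b * snd v2)) = u k"
    for k
    using assms(1) by (auto intro!: periodic_multiple simp: periodic_def)
  ultimately show ?thesis
    by simp
qed

text \<open>In the brick-wall layout the parity of the coordinate sum decides whether the vertical edge
  goes up or down, so translations that preserve this parity are automorphisms.\<close>

lemma neighbors_translate:
  assumes "G = Hexagonal \<Longrightarrow> even (fst t + snd t)"
  shows "neighbors G (i + t) = (\<lambda>j. j + t) ` neighbors G i"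
proof -
  obtain x y p q where [simp]: "i = (x, y)" "t = (p, q)"
    by (cases i, cases t)
  show ?thesis
  proof (cases G)
    case Hexagonal
    then have "even (x + p + (y + q)) \<longleftrightarrow> even (x + y)"
      using assms by auto
    then show ?thesis
      using Hexagonal by (simp add: algebra_simps)
  qed (simp_all add: algebra_simps)
qed

lemma even_lattice:
  assumes "even_vector v1" "even_vector v2" "t \<in> lattice v1 v2"
  shows "even (fst t + snd t)"
  using assms unfolding even_vector_def lattice_def by auto

lemma card_colored_neighbors_cong:
  assumes hex: "G = Hexagonal \<Longrightarrow> even_vector v1 \<and> even_vector v2"
    and eq: "coset v1 v2 i = coset v1 v2 j"
  shows "card {k \<in> neighbors G i. coset v1 v2 k = X} = card {k \<in> neighbors G j. coset v1 v2 k = X}"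
proof -
  define t where "t = j - i"
  have t: "t \<in> lattice v1 v2"
    using eq by (simp add: t_def coset_eq_iff)
  have "neighbors G j = (\<lambda>k. k + t) ` neighbors G i"
    using neighbors_translate[of G t i] even_lattice[OF _ _ t] hex by (simp add: t_def)
  moreover have "coset v1 v2 (k + t) = coset v1 v2 k" for k
    using t by (metis add_diff_cancel_left' coset_eq_iff)
  ultimately have "{k \<in> neighbors G j. coset v1 v2 k = X}
      = (\<lambda>k. k + t) ` {k \<in> neighbors G i. coset v1 v2 k = X}"
    by auto
  then show ?thesis
    by (simp add: card_image)
qed

theorem theorem4p11:
  fixes G :: grid and d :: real and f :: "real \<Rightarrow> real" and v1 v2 :: "int \<times> int"
  assumes "d > 0"
    and "continuous_on UNIV f"
    and "lin_indep_pair v1 v2"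
    and "G = Hexagonal \<Longrightarrow> even_vector v1 \<and> even_vector v2"
  shows "\<exists>n (m :: nat \<Rightarrow> nat \<Rightarrow> nat). n \<ge> 1 \<and> row_sums_eq n m (grid_degree G) \<and>
    (\<forall>u. stationary_solution G d f u \<and> periodic v1 v2 u \<longrightarrow> perfect_solution G n m u)"
proof -
  let ?C = "range (coset v1 v2)"
  define n where "n = card ?C"
  have fin: "finite ?C"
    by (rule finite_cosets[OF assms(3)])
  then have n: "n \<ge> 1"
    by (simp add: n_def Suc_le_eq card_gt_0_iff)
  obtain h where h: "bij_betw h ?C {1..n}"
    using ex_bij_betw_finite_nat[OF fin] fin bij_betw_iff_card[of ?C "{1..n}"] n_def by auto
  define \<Gamma> where "\<Gamma> i = h (coset v1 v2 i)" for i
  define r where "r = inv \<Gamma>"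
  define m where "m a b = card {j \<in> neighbors G (r a). \<Gamma> j = b}" for a b
  have \<Gamma>_range: "range \<Gamma> = {1..n}"
    using bij_betw_imp_surj_on[OF h] by (auto simp: \<Gamma>_def)
  then have \<Gamma>_in: "\<Gamma> i \<in> {1..n}" for i
    by blast
  have \<Gamma>_eq: "\<Gamma> i = \<Gamma> j \<longleftrightarrow> coset v1 v2 i = coset v1 v2 j" for i j
    using bij_betw_imp_inj_on[OF h] by (simp add: \<Gamma>_def inj_on_eq_iff)
  have \<Gamma>_r: "\<Gamma> (r a) = a" if "a \<in> {1..n}" for a
    using that \<Gamma>_range unfolding r_def by (metis f_inv_into_f)
  have perfect: "perfect_coloring G n m \<Gamma>"
    unfolding perfect_coloring_def
  proof (intro conjI allI ballI \<Gamma>_in)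
    fix i c assume "c \<in> {1..n}"
    then obtain l where c: "c = \<Gamma> l"
      using \<Gamma>_range by blast
    have "coset v1 v2 i = coset v1 v2 (r (\<Gamma> i))"
      using \<Gamma>_r[OF \<Gamma>_in] by (simp flip: \<Gamma>_eq)
    from card_colored_neighbors_cong[OF assms(4) this, where X = "coset v1 v2 l"]
    show "card {j \<in> neighbors G i. \<Gamma> j = c} = m (\<Gamma> i) c"
      by (simp add: m_def c \<Gamma>_eq)
  qed
  have "(\<Sum>b\<in>{1..n}. m a b) = grid_degree G" for a
  proof -
    have fin_N: "finite (neighbors G (r a))"
      by (rule card_ge_0_finite) (cases G; simp add: card_neighbors)
    have "neighbors G (r a) = (\<Union>b\<in>{1..n}. {j \<in> neighbors G (r a). \<Gamma> j = b})"
      using \<Gamma>_in by blast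
    then have "card (neighbors G (r a)) = (\<Sum>b\<in>{1..n}. m a b)"
      unfolding m_def using fin_N by (subst card_UN_disjoint[symmetric]) auto
    then show ?thesis
      by (simp add: card_neighbors)
  qed
  then have "row_sums_eq n m (grid_degree G)"
    by (simp add: row_sums_eq_def)
  moreover have "perfect_solution G n m u" if u: "periodic v1 v2 u" for u
  proof -
    have v: "u (r (\<Gamma> i)) = u i" for i
      by (rule periodic_coset_eq[OF u]) (simp add: \<Gamma>_r[OF \<Gamma>_in] flip: \<Gamma>_eq)
    then have "(u \<circ> r) ` {1..n} = range u"
      unfolding \<Gamma>_range[symmetric] by (auto simp: image_image)
    then show ?thesis
      unfolding perfect_solution_def using perfect v by (intro exI[of _ \<Gamma>] exI[of _ "u \<circ> r"]) auto
  qed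
  ultimately show ?thesis
    using n by blast
qed

end
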